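(* Let $n\ge 1$, $k\in\{1,\dots,n\}$, and let $\mathcal S'=\mathcal S'(\mathbf R^n)\otimes M_n(\mathbf C)$, where $\mathcal S'(\mathbf R^n)$ is the space of tempered distributions on $\mathbf R^n$. Let $\tilde X_k^*:\mathcal S'(\mathbf R^n)\to\mathcal S'(\mathbf R^n)$ be multiplication by the $k$-th coordinate, $\tilde X_k^*T=x_k\cdot T$, and let $X^*:\mathcal S'(\mathbf R^n)\to\mathcal S'(\mathbf R^n)$ be $X^*=-D_k$, where $D_k=\frac1i\frac{\partial}{\partial x_k}$ acts on distributions by $(D_kT)(f)=-T(D_kf)$. Let $\mathcal S'_1$ and $\mathcal S'_2$ be $\mathcal S'$ endowed with the coproducts $\bar\Delta_1$ and $\bar\Delta_2$ (defined in the context), dual to pointwise multiplication and to convolution respectively. Then: 1. The operator $\tilde X_k^*\otimes \mathrm{id}_{M_n(\mathbf C)}$ is a coderivation of the coalgebra $\mathcal S'_2$ (it is called the position observable in the position representation). 2. The operator $X^*\otimes\mathrm{id}_{M_n(\mathbf C)}$ is a coderivation of the coalgebra $\mathcal S'_1$ (it is called the position observable in the momentum representation).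
   Context: $\mathcal S(\mathbf R^n)$ is the Schwartz space of smooth, rapidly decreasing complex functions on $\mathbf R^n$, and $\mathcal S'(\mathbf R^n)$ is its dual. On $\mathcal S(\mathbf R^n)$ consider two products: $m_1(f\otimes g)=fg$ (pointwise product) and $m_2(f\otimes g)=f*g$ (usual convolution). For $i=1,2$ the coproduct $\Delta_i:\mathcal S'(\mathbf R^n)\to(\mathcal S(\mathbf R^n)\otimes\mathcal S(\mathbf R^n))'$ is $\Delta_i=m_i^*$, i.e. $(\Delta_iT)(f\otimes g)=T(m_i(f\otimes g))$. (This is a modified notion of coproduct: values lie in the space of linear functionals on $\mathcal S(\mathbf R^n)\otimes\mathcal S(\mathbf R^n)$ rather than in $\mathcal S'(\mathbf R^n)\otimes\mathcal S'(\mathbf R^n)$.) On $M_n(\mathbf C)$, with matrix units $E_{ij}$, the coproduct is the linear map with $\Delta_{M_n(\mathbf C)}(E_{ij})=E_{ij}\otimes E_{ij}$. On $\mathcal S'=\mathcal S'(\mathbf R^n)\otimes M_n(\mathbf C)$ one sets $\bar\Delta_i=\Delta_i\otimes\Delta_{M_n(\mathbf C)}$, with values in $(\mathcal S(\mathbf R^n)\otimes\mathcal S(\mathbf R^n))'\otimes M_n(\mathbf C)\otimes M_n(\mathbf C)$. Coderivations: for a linear map $Z:\mathcal S(\mathbf R^n)\to\mathcal S(\mathbf R^n)$ with adjoint $Z^*$ on $\mathcal S'(\mathbf R^n)$, $(Z^*T)(f)=T(Zf)$, define $Z^*\bar\otimes\mathrm{id}=(Z\otimes\mathrm{id})^*$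 and $\mathrm{id}\,\bar\otimes Z^*=(\mathrm{id}\otimes Z)^*$ on $(\mathcal S(\mathbf R^n)\otimes\mathcal S(\mathbf R^n))'$. The operator $Z^*$ is a coderivation for $\Delta_i$ if it satisfies the co-Leibniz rule $\Delta_i\circ Z^*=(Z^*\bar\otimes\mathrm{id}+\mathrm{id}\,\bar\otimes Z^* )\circ\Delta_i$. Correspondingly, $Z^*\otimes\mathrm{id}_{M_n(\mathbf C)}$ is a coderivation of $\mathcal S'_i=(\mathcal S',\bar\Delta_i)$ if $$\bar\Delta_i\circ(Z^*\otimes\mathrm{id}_{M_n(\mathbf C)})=\big[(Z^*\bar\otimes\mathrm{id}+\mathrm{id}\,\bar\otimes Z^* )\otimes\mathrm{id}_{M_n(\mathbf C)\otimes M_n(\mathbf C)}\big]\circ\bar\Delta_i .$$ Here $\tilde X_k^*$ is the adjoint of $f\mapsto x_kf$, and $X^*=-D_k$ is the adjoint of $f\mapsto D_kf$. *)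

theory Defs
  imports "HOL-Analysis.Analysis" "HOL-Library.Poly_Mapping"
    "HOL-Probability.Sinc_Integral"
begin

section \<open>Complex vector spaces, linear maps and tensor products\<close>

class complex_vector = ab_group_add +
  fixes scaleC :: "complex \<Rightarrow> 'a \<Rightarrow> 'a"  (infixr \<open>*\<^sub>C\<close> 75)
  assumes scaleC_add_right: "a *\<^sub>C (x + y) = a *\<^sub>C x + a *\<^sub>C y"
    and scaleC_add_left: "(a + b) *\<^sub>C x = a *\<^sub>C x + b *\<^sub>C x"
    and scaleC_scaleC: "a *\<^sub>C b *\<^sub>C x = (a * b) *\<^sub>C x"
    and scaleC_one: "1 *\<^sub>C x = x"

global_interpretation complex_vector: vector_space "scaleC :: complex \<Rightarrow> 'a \<Rightarrow> 'a::complex_vector"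
  defines cspan = complex_vector.span
  by unfold_locales (simp_all add: scaleC_add_right scaleC_add_left scaleC_scaleC scaleC_one)

abbreviation clinear :: "('a::complex_vector \<Rightarrow> 'b::complex_vector) \<Rightarrow> bool"
  where "clinear \<equiv> Vector_Spaces.linear scaleC scaleC"

lemma clinear_iff:
  "clinear f \<longleftrightarrow> (\<forall>x y. f (x + y) = f x + f y) \<and> (\<forall>c x. f (c *\<^sub>C x) = c *\<^sub>C f x)"
  by (simp add: Vector_Spaces.linear_iff complex_vector.vector_space_axioms)

instantiation complex :: complex_vector
begin
definition scaleC_complex :: "complex \<Rightarrow> complex \<Rightarrow> complex"
  where [simp]: "scaleC_complex c z = c * z"
instance by standard (simp_all add: algebra_simps)
end

instantiation vec :: (complex_vector, finite) complex_vector
begin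
definition scaleC_vec :: "complex \<Rightarrow> 'a ^ 'b \<Rightarrow> 'a ^ 'b"
  where "c *\<^sub>C v = (\<chi> i. c *\<^sub>C v $ i)"
instance
  by standard (simp_all add: scaleC_vec_def vec_eq_iff scaleC_add_right scaleC_add_left
      scaleC_scaleC scaleC_one)
end

instantiation poly_mapping :: (type, complex_vector) complex_vector
begin
lift_definition scaleC_poly_mapping :: "complex \<Rightarrow> ('a \<Rightarrow>\<^sub>0 'b) \<Rightarrow> ('a \<Rightarrow>\<^sub>0 'b)"
  is "\<lambda>c p x. c *\<^sub>C p x"
  by (rule finite_subset) auto
instance
  by standard (transfer, simp add: fun_eq_iff scaleC_add_right scaleC_add_left
      scaleC_scaleC scaleC_one)+
end

typedef (overloaded) ('a, 'b) clinmap = "{f :: 'a::complex_vector \<Rightarrow> 'b::complex_vector. clinear f}"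
  morphisms clinmap_apply Clinmap
  by (rule exI[of _ "\<lambda>_. 0"]) (simp add: clinear_iff)

setup_lifting type_definition_clinmap

notation clinmap_apply (infixl \<open>\<cdot>\<close> 90)

lemma clinmap_eqI: "(\<And>x. f \<cdot> x = g \<cdot> x) \<Longrightarrow> f = g"
  by (metis clinmap_apply_inject ext)

lemma clinmap_add: "f \<cdot> (x + y) = f \<cdot> x + f \<cdot> y"
  and clinmap_scaleC: "f \<cdot> (c *\<^sub>C x) = c *\<^sub>C (f \<cdot> x)"
  using clinmap_apply[of f] by (simp_all add: clinear_iff)

instantiation clinmap :: (complex_vector, complex_vector) complex_vector
begin
lift_definition zero_clinmap :: "('a, 'b) clinmap" is "\<lambda>_. 0"
  by (simp add: clinear_iff)
lift_definition plus_clinmap :: "('a, 'b) clinmap \<Rightarrow> ('a, 'b) clinmap \<Rightarrow> ('a, 'b) clinmap"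
  is "\<lambda>f g x. f x + g x"
  by (simp add: clinear_iff scaleC_add_right)
lift_definition uminus_clinmap :: "('a, 'b) clinmap \<Rightarrow> ('a, 'b) clinmap"
  is "\<lambda>f x. - f x"
  by (simp add: clinear_iff)
lift_definition minus_clinmap :: "('a, 'b) clinmap \<Rightarrow> ('a, 'b) clinmap \<Rightarrow> ('a, 'b) clinmap"
  is "\<lambda>f g x. f x - g x"
  by (simp add: clinear_iff complex_vector.scale_right_diff_distrib)
lift_definition scaleC_clinmap :: "complex \<Rightarrow> ('a, 'b) clinmap \<Rightarrow> ('a, 'b) clinmap"
  is "\<lambda>c f x. c *\<^sub>C f x"
  by (simp add: clinear_iff scaleC_add_right scaleC_scaleC mult.commute)
instance
  by standard (transfer, simp add: fun_eq_iff scaleC_add_right scaleC_add_left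
      scaleC_scaleC scaleC_one)+
end

lift_definition clinmap_id :: "('a::complex_vector, 'a) clinmap" is "\<lambda>x. x"
  by (simp add: clinear_iff)

lift_definition clinmap_compose ::
  "('b::complex_vector, 'c::complex_vector) clinmap \<Rightarrow> ('a::complex_vector, 'b) clinmap \<Rightarrow> ('a, 'c) clinmap"
  (infixl \<open>\<circ>\<^sub>C\<close> 55) is "\<lambda>f g x. f (g x)"
  by (simp add: clinear_iff)

type_synonym 'a cdual = "('a, complex) clinmap"

lift_definition transpose_map ::
  "('a::complex_vector, 'b::complex_vector) clinmap \<Rightarrow> ('b cdual, 'a cdual) clinmap"
  is "\<lambda>F \<phi>. \<phi> \<circ>\<^sub>C F"
  unfolding clinear_iff by (intro conjI allI; rule clinmap_eqI; transfer; simp)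

text \<open>
  \<open>'a cdual\<close> is the algebraic dual.  The algebraic tensor product over the complex numbers: the free vector space on pairs,
  modulo the subspace generated by the bilinearity relations.
\<close>

abbreviation free_pair :: "'a \<Rightarrow> 'b \<Rightarrow> ('a \<times> 'b) \<Rightarrow>\<^sub>0 complex"
  where "free_pair a b \<equiv> Poly_Mapping.single (a, b) 1"

definition tensor_relations :: "(('a::complex_vector \<times> 'b::complex_vector) \<Rightarrow>\<^sub>0 complex) set"
  where "tensor_relations =
    {free_pair (a + a') b - free_pair a b - free_pair a' b | a a' b. True} \<union>
    {free_pair a (b + b') - free_pair a b - free_pair a b' | a b b'. True} \<union>
    {free_pair (c *\<^sub>C a) b - c *\<^sub>C free_pair a b | a b c. True} \<union>
    {free_pair a (c *\<^sub>C b) - c *\<^sub>C free_pair a b | a b c. True}"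

lemma equivp_cspan: "equivp (\<lambda>p q. p - q \<in> cspan S)"
proof (rule equivpI)
  show "reflp (\<lambda>p q. p - q \<in> cspan S)"
    by (simp add: reflp_def complex_vector.span_zero)
  show "symp (\<lambda>p q. p - q \<in> cspan S)"
    using complex_vector.span_neg[of _ S] by (fastforce simp: symp_def)
  show "transp (\<lambda>p q. p - q \<in> cspan S)"
    using complex_vector.span_add[of _ S] by (fastforce simp: transp_def)
qed

quotient_type (overloaded) ('a, 'b) tensor (infixr \<open>\<otimes>\<close> 80) =
  "('a::complex_vector \<times> 'b::complex_vector) \<Rightarrow>\<^sub>0 complex" /
  "\<lambda>p q. p - q \<in> cspan tensor_relations"
  by (rule equivp_cspan)

instantiation tensor :: (complex_vector, complex_vector) complex_vector
begin
lift_definition zero_tensor :: "'a \<otimes> 'b" is 0 .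
lift_definition plus_tensor :: "'a \<otimes> 'b \<Rightarrow> 'a \<otimes> 'b \<Rightarrow> 'a \<otimes> 'b" is "(+)"
  by (metis (no_types, lifting) add_diff_add complex_vector.span_add)
lift_definition uminus_tensor :: "'a \<otimes> 'b \<Rightarrow> 'a \<otimes> 'b" is uminus
  by (metis minus_diff_minus complex_vector.span_neg)
lift_definition minus_tensor :: "'a \<otimes> 'b \<Rightarrow> 'a \<otimes> 'b \<Rightarrow> 'a \<otimes> 'b" is "(-)"
  by (drule (1) complex_vector.span_diff) (simp add: algebra_simps)
lift_definition scaleC_tensor :: "complex \<Rightarrow> 'a \<otimes> 'b \<Rightarrow> 'a \<otimes> 'b" is scaleC
  by (metis complex_vector.scale_right_diff_distrib complex_vector.span_scale)
instance
proof
  fix s t u :: "'a \<otimes> 'b" and a b :: complex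
  obtain p q r where pqr: "s = abs_tensor p" "t = abs_tensor q" "u = abs_tensor r"
    by (metis Quotient_abs_rep[OF Quotient_tensor])
  note eqs = zero_tensor_def plus_tensor.abs_eq uminus_tensor.abs_eq minus_tensor.abs_eq
    scaleC_tensor.abs_eq
  show "s + t + u = s + (t + u)" "s + t = t + s" "0 + s = s" "- s + s = 0" "s - t = s + - t"
    "a *\<^sub>C (s + t) = a *\<^sub>C s + a *\<^sub>C t" "(a + b) *\<^sub>C s = a *\<^sub>C s + b *\<^sub>C s"
    "a *\<^sub>C b *\<^sub>C s = (a * b) *\<^sub>C s" "1 *\<^sub>C s = s"
    unfolding pqr by (simp_all add: eqs ac_simps scaleC_add_right scaleC_add_left)
qed
end

lift_definition tmul :: "'a::complex_vector \<Rightarrow> 'b::complex_vector \<Rightarrow> 'a \<otimes> 'b" (infixr \<open>\<otimes>\<^sub>t\<close> 80)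
  is "\<lambda>a b. free_pair a b" .

definition cbilinear :: "('a::complex_vector \<Rightarrow> 'b::complex_vector \<Rightarrow> 'c::complex_vector) \<Rightarrow> bool"
  where "cbilinear B \<longleftrightarrow> (\<forall>b. clinear (\<lambda>a. B a b)) \<and> (\<forall>a. clinear (B a))"

lemma tmul_add_left: "(a + a') \<otimes>\<^sub>t b = a \<otimes>\<^sub>t b + a' \<otimes>\<^sub>t b"
  apply transfer
  subgoal for a a' b
    using complex_vector.span_base[of "free_pair (a + a') b - free_pair a b - free_pair a' b"
        tensor_relations] 
    by (fastforce simp: tensor_relations_def diff_diff_eq)
  done

lemma tmul_add_right: "a \<otimes>\<^sub>t (b + b') = a \<otimes>\<^sub>t b + a \<otimes>\<^sub>t b'"
  apply transfer
  subgoal for a b b'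
    using complex_vector.span_base[of "free_pair a (b + b') - free_pair a b - free_pair a b'"
        tensor_relations]
    by (fastforce simp: tensor_relations_def diff_diff_eq)
  done

lemma tmul_scaleC_left: "(c *\<^sub>C a) \<otimes>\<^sub>t b = c *\<^sub>C (a \<otimes>\<^sub>t b)"
  apply transfer
  by (rule complex_vector.span_base) (unfold tensor_relations_def, blast)

lemma tmul_scaleC_right: "a \<otimes>\<^sub>t (c *\<^sub>C b) = c *\<^sub>C (a \<otimes>\<^sub>t b)"
  apply transfer
  by (rule complex_vector.span_base) (unfold tensor_relations_def, blast)

lemma cbilinear_tmul: "cbilinear (\<otimes>\<^sub>t)"
  by (simp add: cbilinear_def clinear_iff tmul_add_left tmul_add_right
      tmul_scaleC_left tmul_scaleC_right)

lemma lookup_scaleC: "Poly_Mapping.lookup (c *\<^sub>C p) x = c *\<^sub>C Poly_Mapping.lookup p x"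
  by transfer simp

lemma free_in_cspan:
  fixes p :: "('a::complex_vector \<times> 'b::complex_vector) \<Rightarrow>\<^sub>0 complex"
  shows "p \<in> cspan {free_pair a b | a b. True}"
proof -
  have "p = (\<Sum>x\<in>Poly_Mapping.keys p. Poly_Mapping.lookup p x *\<^sub>C free_pair (fst x) (snd x))"
    by (rule poly_mapping_eqI)
      (auto simp: Poly_Mapping.lookup_sum lookup_scaleC lookup_single when_def in_keys_iff if_distrib sum.delta
        cong: if_cong)
  moreover have "\<dots> \<in> cspan {free_pair a b | a b. True}"
    by (intro complex_vector.span_sum complex_vector.span_scale complex_vector.span_base) auto
  ultimately show ?thesis by simp
qed

lemma tensor_induct [case_names add scaleC tmul]:
  assumes "\<And>s t. P s \<Longrightarrow> P t \<Longrightarrow> P (s + t)" "\<And>c t. P t \<Longrightarrow> P (c *\<^sub>C t)" "\<And>a b. P (a \<otimes>\<^sub>t b)"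
  shows "P t"
proof -
  have "P (abs_tensor p)" for p
    using free_in_cspan[of p]
  proof (induction rule: complex_vector.span_induct_alt)
    case base
    have "0 *\<^sub>C (0 \<otimes>\<^sub>t 0) = (abs_tensor 0 :: 'a \<otimes> 'b)"
      by (simp add: zero_tensor.abs_eq)
    then show ?case using assms(2,3) by metis
  next
    case (step c x y)
    then show ?case
      by (auto simp flip: plus_tensor.abs_eq scaleC_tensor.abs_eq tmul.abs_eq intro!: assms)
  qed
  then show ?thesis by (metis Quotient_abs_rep[OF Quotient_tensor])
qed

lemma tensor_clinmap_eqI:
  assumes "\<And>a b. F \<cdot> (a \<otimes>\<^sub>t b) = G \<cdot> (a \<otimes>\<^sub>t b)" shows "F = G"
proof (rule clinmap_eqI)
  fix t show "F \<cdot> t = G \<cdot> t"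
    by (induction t rule: tensor_induct) (simp_all add: assms clinmap_add clinmap_scaleC)
qed

lemma clinmap_zero: "f \<cdot> 0 = 0"
  by (metis clinmap_add add_cancel_right_right)

lemma clinmap_diff: "f \<cdot> (x - y) = f \<cdot> x - f \<cdot> y"
  by (metis clinmap_add diff_add_cancel eq_diff_eq)

lift_definition free_extend :: "('x \<Rightarrow> 'c::complex_vector) \<Rightarrow> ('x \<Rightarrow>\<^sub>0 complex, 'c) clinmap"
  is "\<lambda>B p. \<Sum>x\<in>Poly_Mapping.keys p. Poly_Mapping.lookup p x *\<^sub>C B x"
proof -
  fix B :: "'x \<Rightarrow> 'c"
  have *: "(\<Sum>x\<in>Poly_Mapping.keys p. Poly_Mapping.lookup p x *\<^sub>C B x) =
      (\<Sum>x\<in>A. Poly_Mapping.lookup p x *\<^sub>C B x)"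
    if "finite A" "Poly_Mapping.keys p \<subseteq> A" for p :: "'x \<Rightarrow>\<^sub>0 complex" and A
    using that by (intro sum.mono_neutral_left) (auto simp: in_keys_iff)
  show "clinear (\<lambda>p. \<Sum>x\<in>Poly_Mapping.keys p. Poly_Mapping.lookup p x *\<^sub>C B x)"
    unfolding clinear_iff
  proof (intro conjI allI)
    fix p q :: "'x \<Rightarrow>\<^sub>0 complex"
    let ?A = "Poly_Mapping.keys p \<union> Poly_Mapping.keys q"
    show "(\<Sum>x\<in>Poly_Mapping.keys (p + q). Poly_Mapping.lookup (p + q) x *\<^sub>C B x) =
      (\<Sum>x\<in>Poly_Mapping.keys p. Poly_Mapping.lookup p x *\<^sub>C B x) +
      (\<Sum>x\<in>Poly_Mapping.keys q. Poly_Mapping.lookup q x *\<^sub>C B x)"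
      unfolding *[of ?A p, simplified] *[of ?A q, simplified]
        *[of ?A "p + q", OF _ Poly_Mapping.keys_add, simplified]
      by (simp add: lookup_add scaleC_add_left sum.distrib)
  next
    fix c and p :: "'x \<Rightarrow>\<^sub>0 complex"
    have "Poly_Mapping.keys (c *\<^sub>C p) \<subseteq> Poly_Mapping.keys p"
      by (auto simp: in_keys_iff lookup_scaleC)
    then show "(\<Sum>x\<in>Poly_Mapping.keys (c *\<^sub>C p). Poly_Mapping.lookup (c *\<^sub>C p) x *\<^sub>C B x) =
      c *\<^sub>C (\<Sum>x\<in>Poly_Mapping.keys p. Poly_Mapping.lookup p x *\<^sub>C B x)"
      using *[of "Poly_Mapping.keys p" "c *\<^sub>C p"]
      by (simp add: lookup_scaleC complex_vector.scale_sum_right)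
  qed
qed

lemma free_extend_single: "free_extend B \<cdot> Poly_Mapping.single x 1 = B x"
  by transfer simp

theorem tensor_universal:
  assumes "cbilinear B"
  shows "\<exists>!L :: ('a::complex_vector \<otimes> 'b::complex_vector, 'c::complex_vector) clinmap.
    \<forall>a b. L \<cdot> (a \<otimes>\<^sub>t b) = B a b"
proof (rule ex_ex1I)
  define F where "F = free_extend (case_prod B)"
  have F: "F \<cdot> free_pair a b = B a b" for a b
    by (simp add: F_def free_extend_single)
  have B: "B (a + a') b = B a b + B a' b" "B a (b + b') = B a b + B a b'"
    "B (c *\<^sub>C a) b = c *\<^sub>C B a b" "B a (c *\<^sub>C b) = c *\<^sub>C B a b" for a a' b b' c
    using assms by (simp_all add: cbilinear_def clinear_iff)
  have F0: "F \<cdot> p = 0" if "p \<in> cspan tensor_relations" for p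
    using that
  proof (induction rule: complex_vector.span_induct_alt)
    case (step c x y)
    have "F \<cdot> x = 0"
      using step(1) unfolding tensor_relations_def
      by (elim UnE CollectE exE conjE) (simp_all add: clinmap_diff clinmap_scaleC F B)
    then show ?case
      by (simp add: clinmap_add clinmap_scaleC step)
  qed (simp add: clinmap_zero)
  have F1: "F \<cdot> p = F \<cdot> q" if "p - q \<in> cspan tensor_relations" for p q
    using F0[OF that] by (simp add: clinmap_diff)
  define L where "L t = F \<cdot> rep_tensor t" for t
  have L: "L (abs_tensor p) = F \<cdot> p" for p
    unfolding L_def
    by (rule F1) (use Quotient_rep_abs[OF Quotient_tensor] in
      \<open>simp add: complex_vector.span_zero\<close>)
  have "clinear L"
    unfolding clinear_iff
  proof (intro conjI allI)
    fix s t :: "'a \<otimes> 'b" and c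
    obtain p q where pq: "s = abs_tensor p" "t = abs_tensor q"
      by (metis Quotient_abs_rep[OF Quotient_tensor])
    show "L (s + t) = L s + L t"
      unfolding pq by (simp add: plus_tensor.abs_eq L clinmap_add)
    show "L (c *\<^sub>C s) = c *\<^sub>C L s"
      unfolding pq by (simp add: scaleC_tensor.abs_eq L clinmap_scaleC)
  qed
  then have LC: "Clinmap L \<cdot> (a \<otimes>\<^sub>t b) = B a b" for a b
    by (simp add: Clinmap_inverse tmul.abs_eq L F)
  show "\<exists>L. \<forall>a b. L \<cdot> (a \<otimes>\<^sub>t b) = B a b"
    by (rule exI[of _ "Clinmap L"]) (simp only: LC simp_thms)
next
  fix L M :: "('a \<otimes> 'b, 'c) clinmap"
  assume "\<forall>a b. L \<cdot> (a \<otimes>\<^sub>t b) = B a b" "\<forall>a b. M \<cdot> (a \<otimes>\<^sub>t b) = B a b"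
  then show "L = M"
    by (intro tensor_clinmap_eqI) simp
qed

text \<open>
  The linear map induced by a bilinear map \<open>B\<close>; unspecified if \<open>B\<close> is not bilinear.
\<close>

definition tensor_lift ::
  "('a::complex_vector \<Rightarrow> 'b::complex_vector \<Rightarrow> 'c::complex_vector) \<Rightarrow> ('a \<otimes> 'b, 'c) clinmap"
  where "tensor_lift B = (THE L. \<forall>a b. L \<cdot> (a \<otimes>\<^sub>t b) = B a b)"

lemma tensor_lift_tmul:
  assumes "cbilinear B" shows "tensor_lift B \<cdot> (a \<otimes>\<^sub>t b) = B a b"
  using theI'[OF tensor_universal[OF assms]] by (simp add: tensor_lift_def)

definition tensor_map ::
  "('a::complex_vector, 'c::complex_vector) clinmap \<Rightarrow> ('b::complex_vector, 'd::complex_vector) clinmap \<Rightarrow>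
   ('a \<otimes> 'b, 'c \<otimes> 'd) clinmap" (infixr \<open>\<otimes>\<^sub>m\<close> 80)
  where "F \<otimes>\<^sub>m G = tensor_lift (\<lambda>a b. (F \<cdot> a) \<otimes>\<^sub>t (G \<cdot> b))"

lemma tensor_map_tmul: "(F \<otimes>\<^sub>m G) \<cdot> (a \<otimes>\<^sub>t b) = (F \<cdot> a) \<otimes>\<^sub>t (G \<cdot> b)"
  unfolding tensor_map_def
  by (rule tensor_lift_tmul)
    (simp add: cbilinear_def clinear_iff clinmap_add clinmap_scaleC tmul_add_left tmul_add_right
      tmul_scaleC_left tmul_scaleC_right)

section \<open>Schwartz functions\<close>

definition partial_deriv :: "'n::finite \<Rightarrow> (real ^ 'n \<Rightarrow> complex) \<Rightarrow> real ^ 'n \<Rightarrow> complex"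
  where "partial_deriv k f x = frechet_derivative f (at x) (axis k 1)"

text \<open>
  Iterated partial derivatives are indexed by lists of coordinate directions instead of
  multi-indices.  Differentiability of all of them makes each of them continuous, so the first
  conjunct is smoothness.  The factor \<open>norm x ^ m\<close> replaces the monomials in the coordinates and
  gives the same space and an equivalent family of seminorms.
\<close>

definition schwartz_fun :: "(real ^ 'n::finite \<Rightarrow> complex) \<Rightarrow> bool"
  where "schwartz_fun f \<longleftrightarrow>
    (\<forall>ks x. foldr partial_deriv ks f differentiable at x) \<and>
    (\<forall>ks m. \<exists>C. \<forall>x. norm x ^ m * norm (foldr partial_deriv ks f x) \<le> C)"

lemma schwartz_fun_coinduct:
  assumes "P f"
    and step: "\<And>f. P f \<Longrightarrow> (\<forall>x. f differentiable at x) \<and>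
      (\<forall>m. \<exists>C. \<forall>x. norm x ^ m * norm (f x) \<le> C) \<and> (\<forall>k. P (partial_deriv k f))"
  shows "schwartz_fun f"
proof -
  have "P (foldr partial_deriv ks f)" for ks
    by (induction ks) (use assms in auto)
  then show ?thesis
    using step unfolding schwartz_fun_def by blast
qed

lemma schwartz_fun_differentiable: "schwartz_fun f \<Longrightarrow> f differentiable at x"
  unfolding schwartz_fun_def by (metis foldr_Nil id_apply)

lemma schwartz_fun_decay: "schwartz_fun f \<Longrightarrow> \<exists>C. \<forall>x. norm x ^ m * norm (f x) \<le> C"
  unfolding schwartz_fun_def by (metis foldr_Nil id_apply)

lemma schwartz_fun_decayE:
  assumes "schwartz_fun f"
  obtains C where "C \<ge> 0" "\<And>x. norm x ^ m * norm (f x) \<le> C"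
proof -
  obtain C where "\<forall>x. norm x ^ m * norm (f x) \<le> C"
    using schwartz_fun_decay[OF assms] by blast
  then show ?thesis
    by (intro that[of "\<bar>C\<bar>"]) (auto intro: order_trans)
qed

lemma schwartz_fun_partial: "schwartz_fun f \<Longrightarrow> schwartz_fun (partial_deriv k f)"
  unfolding schwartz_fun_def
proof safe
  fix ks x m
  assume *: "\<forall>ks x. foldr partial_deriv ks f differentiable at x"
    "\<forall>ks m. \<exists>C. \<forall>x. norm x ^ m * norm (foldr partial_deriv ks f x) \<le> C"
  have eq: "foldr partial_deriv ks (partial_deriv k f) = foldr partial_deriv (ks @ [k]) f"
    by simp
  show "foldr partial_deriv ks (partial_deriv k f) differentiable at x"
    using *(1) unfolding eq by blast
  show "\<exists>C. \<forall>x. norm x ^ m * norm (foldr partial_deriv ks (partial_deriv k f) x) \<le> C"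
    using *(2) unfolding eq by blast
qed

lemma has_derivative_partial:
  assumes "f differentiable at x"
  shows "(f has_derivative (\<lambda>h. \<Sum>k\<in>UNIV. h $ k *\<^sub>R partial_deriv k f x)) (at x)"
proof -
  let ?D = "frechet_derivative f (at x)"
  have D: "(f has_derivative ?D) (at x)"
    using assms by (simp add: frechet_derivative_works)
  then interpret bounded_linear ?D
    by (rule has_derivative_bounded_linear)
  have "?D h = (\<Sum>k\<in>UNIV. h $ k *\<^sub>R partial_deriv k f x)" for h
  proof -
    have "h = (\<Sum>k\<in>UNIV. h $ k *\<^sub>R axis k 1)"
      by (metis (no_types, lifting) basis_expansion scalar_mult_eq_scaleR sum.cong)
    then have "?D h = ?D (\<Sum>k\<in>UNIV. h $ k *\<^sub>R axis k 1)" by simp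
    then show ?thesis
      by (simp add: sum scaleR partial_deriv_def)
  qed
  with D show ?thesis
    by (metis (no_types, lifting) has_derivative_eq_rhs ext)
qed

lemma partial_deriv_eq:
  assumes "(f has_derivative f') (at x)"
  shows "partial_deriv k f x = f' (axis k 1)"
  using frechet_derivative_at[OF assms] by (simp add: partial_deriv_def)

lemma partial_deriv_works:
  "f differentiable at x \<Longrightarrow> (f has_derivative frechet_derivative f (at x)) (at x)"
  by (simp add: frechet_derivative_works)

lemma partial_deriv_add:
  assumes "f differentiable at x" "g differentiable at x"
  shows "partial_deriv k (\<lambda>x. f x + g x) x = partial_deriv k f x + partial_deriv k g x"
  using partial_deriv_eq[OF has_derivative_add[OF assms[THEN partial_deriv_works]]]
  by (simp add: partial_deriv_def)

lemma partial_deriv_mult: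
  assumes "f differentiable at x" "g differentiable at x"
  shows "partial_deriv k (\<lambda>x. f x * g x) x = f x * partial_deriv k g x + partial_deriv k f x * g x"
  using partial_deriv_eq[OF has_derivative_mult[OF assms[THEN partial_deriv_works]]]
  by (simp add: partial_deriv_def)

lemma has_derivative_coord:
  "((\<lambda>x::real^'n::finite. complex_of_real (x $ k)) has_derivative (\<lambda>h. complex_of_real (h $ k))) (at x)"
  by (intro has_derivative_of_real bounded_linear_imp_has_derivative bounded_linear_vec_nth)

lemma partial_deriv_coord:
  "partial_deriv j (\<lambda>x. complex_of_real (x $ k)) x = (if j = k then 1 else 0)"
  using partial_deriv_eq[OF has_derivative_coord[of k x], of j] by (simp add: axis_def)

lemma coord_differentiable: "(\<lambda>x::real^'n::finite. complex_of_real (x $ k)) differentiable at x"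
  using has_derivative_coord differentiable_def by blast

lemma schwartz_fun_zero: "schwartz_fun (\<lambda>_ :: real ^ 'n::finite. 0)"
proof (rule schwartz_fun_coinduct[of "\<lambda>f. f = (\<lambda>_. 0)"])
  have "partial_deriv k (\<lambda>_. 0) = (\<lambda>_. 0)" for k :: 'n
    by (rule ext) (simp add: partial_deriv_def frechet_derivative_const)
  then show "(\<forall>x. f differentiable at x) \<and>
      (\<forall>m. \<exists>C. \<forall>x. norm x ^ m * norm (f x) \<le> C) \<and> (\<forall>k. partial_deriv k f = (\<lambda>_. 0))"
    if "f = (\<lambda>_. 0)" for f :: "real ^ 'n \<Rightarrow> complex"
    using that by auto
qed simp

lemma decay_add:
  assumes "\<exists>C. \<forall>x. norm x ^ m * norm (f x) \<le> C" "\<exists>C. \<forall>x. norm x ^ m * norm (g x) \<le> C"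
  shows "\<exists>C. \<forall>x. norm x ^ m * norm (f x + g x :: complex) \<le> C"
proof -
  obtain C D where CD: "\<And>x. norm x ^ m * norm (f x) \<le> C" "\<And>x. norm x ^ m * norm (g x) \<le> D"
    using assms by blast
  have "norm x ^ m * norm (f x + g x) \<le> C + D" for x
  proof -
    have "norm x ^ m * norm (f x + g x) \<le> norm x ^ m * (norm (f x) + norm (g x))"
      by (intro mult_left_mono norm_triangle_ineq) simp
    also have "\<dots> \<le> C + D"
      using CD[of x] by (simp add: distrib_left)
    finally show ?thesis .
  qed
  then show ?thesis by blast
qed

lemma schwartz_fun_add:
  assumes "schwartz_fun f" "schwartz_fun g"
  shows "schwartz_fun (\<lambda>x. f x + g x)"
proof (rule schwartz_fun_coinduct[of "\<lambda>h. \<exists>f g. schwartz_fun f \<and> schwartz_fun g \<and> h = (\<lambda>x. f x + g x)"])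
  fix h :: "real ^ 'n \<Rightarrow> complex"
  assume "\<exists>f g. schwartz_fun f \<and> schwartz_fun g \<and> h = (\<lambda>x. f x + g x)"
  then obtain f g where fg: "schwartz_fun f" "schwartz_fun g" and h: "h = (\<lambda>x. f x + g x)"
    by blast
  have "partial_deriv k h = (\<lambda>x. partial_deriv k f x + partial_deriv k g x)" for k
    unfolding h by (intro ext partial_deriv_add fg[THEN schwartz_fun_differentiable])
  then have "\<forall>k. \<exists>f g. schwartz_fun f \<and> schwartz_fun g \<and> partial_deriv k h = (\<lambda>x. f x + g x)"
    using fg schwartz_fun_partial by blast
  moreover have "\<forall>x. h differentiable at x"
    using fg unfolding h by (intro allI differentiable_add schwartz_fun_differentiable)
  moreover have "\<forall>m. \<exists>C. \<forall>x. norm x ^ m * norm (h x) \<le> C"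
    using fg unfolding h by (intro allI decay_add schwartz_fun_decay)
  ultimately show "(\<forall>x. h differentiable at x) \<and> (\<forall>m. \<exists>C. \<forall>x. norm x ^ m * norm (h x) \<le> C) \<and>
      (\<forall>k. \<exists>f g. schwartz_fun f \<and> schwartz_fun g \<and> partial_deriv k h = (\<lambda>x. f x + g x))"
    by blast
qed (use assms in blast)

inductive mult_sums :: "(real ^ 'n::finite \<Rightarrow> complex) \<Rightarrow> bool" where
  mult: "schwartz_fun f \<Longrightarrow> schwartz_fun g \<Longrightarrow> mult_sums (\<lambda>x. f x * g x)"
| add: "mult_sums f \<Longrightarrow> mult_sums g \<Longrightarrow> mult_sums (\<lambda>x. f x + g x)"

lemma schwartz_fun_mult:
  assumes "schwartz_fun f" "schwartz_fun g"
  shows "schwartz_fun (\<lambda>x. f x * g x)"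
proof (rule schwartz_fun_coinduct[of mult_sums])
  show "mult_sums (\<lambda>x. f x * g x)"
    using assms by (rule mult_sums.mult)
  fix h :: "real ^ 'n \<Rightarrow> complex" assume "mult_sums h"
  then show "(\<forall>x. h differentiable at x) \<and>
      (\<forall>m. \<exists>C. \<forall>x. norm x ^ m * norm (h x) \<le> C) \<and> (\<forall>k. mult_sums (partial_deriv k h))"
  proof induction
    case (mult f g)
    have "partial_deriv k (\<lambda>x. f x * g x) =
        (\<lambda>x. f x * partial_deriv k g x + partial_deriv k f x * g x)" for k
      by (intro ext partial_deriv_mult mult[THEN schwartz_fun_differentiable])
    moreover have "mult_sums (\<lambda>x. f x * partial_deriv k g x + partial_deriv k f x * g x)" for k
      by (intro mult_sums.intros mult schwartz_fun_partial)
    moreover have "\<exists>C. \<forall>x. norm x ^ m * norm (f x * g x) \<le> C" for m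
    proof -
      obtain C where C: "C \<ge> 0" "\<And>x. norm x ^ m * norm (f x) \<le> C"
        using schwartz_fun_decayE[OF mult(1)] by blast
      obtain D where D: "D \<ge> 0" "\<And>x. norm x ^ 0 * norm (g x) \<le> D"
        using schwartz_fun_decayE[OF mult(2)] by blast
      have "norm x ^ m * norm (f x * g x) \<le> C * D" for x
        using mult_mono[OF C(2)[of x] D(2)[of x] C(1)] by (simp add: norm_mult mult.assoc)
      then show ?thesis by blast
    qed
    moreover have "\<forall>x. (\<lambda>x. f x * g x) differentiable at x"
      using mult by (intro allI differentiable_mult schwartz_fun_differentiable)
    ultimately show ?case
      by simp
  next
    case (add f g)
    have "partial_deriv k (\<lambda>x. f x + g x) = (\<lambda>x. partial_deriv k f x + partial_deriv k g x)" for k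
      using add by (intro ext partial_deriv_add) auto
    moreover have "mult_sums (\<lambda>x. partial_deriv k f x + partial_deriv k g x)" for k
      using add by (intro mult_sums.add) auto
    moreover have "\<exists>C. \<forall>x. norm x ^ m * norm (f x + g x) \<le> C" for m
      using add by (intro decay_add) auto
    ultimately show ?case
      using add by (auto intro!: differentiable_add)
  qed
qed

lemma schwartz_fun_coord_affine:
  fixes f g :: "real ^ 'n::finite \<Rightarrow> complex"
  assumes "schwartz_fun f" "schwartz_fun g"
  shows "schwartz_fun (\<lambda>x. f x + complex_of_real (x $ k) * g x)"
proof (rule schwartz_fun_coinduct[of
      "\<lambda>h. \<exists>f g. schwartz_fun f \<and> schwartz_fun g \<and> h = (\<lambda>x. f x + complex_of_real (x $ k) * g x)"])
  fix h :: "real ^ 'n \<Rightarrow> complex"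
  assume "\<exists>f g. schwartz_fun f \<and> schwartz_fun g \<and> h = (\<lambda>x. f x + complex_of_real (x $ k) * g x)"
  then obtain f g where fg: "schwartz_fun f" "schwartz_fun g"
    and h: "h = (\<lambda>x. f x + complex_of_real (x $ k) * g x)"
    by blast
  have d: "(\<lambda>x. complex_of_real (x $ k) * g x) differentiable at x" for x
    by (intro differentiable_mult coord_differentiable schwartz_fun_differentiable fg)
  have "partial_deriv j h = (\<lambda>x. (partial_deriv j f x + (if j = k then g x else 0)) +
      complex_of_real (x $ k) * partial_deriv j g x)" for j
  proof
    fix x
    show "partial_deriv j h x = (partial_deriv j f x + (if j = k then g x else 0)) +
      complex_of_real (x $ k) * partial_deriv j g x"
      unfolding h
      using fg by (simp add: partial_deriv_add d partial_deriv_mult schwartz_fun_differentiable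
          coord_differentiable partial_deriv_coord)
  qed
  moreover have "schwartz_fun (\<lambda>x. partial_deriv j f x + (if j = k then g x else 0))" for j
    using fg by (cases "j = k") (simp_all add: schwartz_fun_add schwartz_fun_partial)
  ultimately have "\<forall>j. \<exists>f g. schwartz_fun f \<and> schwartz_fun g \<and>
      partial_deriv j h = (\<lambda>x. f x + complex_of_real (x $ k) * g x)"
    using schwartz_fun_partial[OF fg(2)] by (intro allI exI conjI)
  moreover have "\<forall>x. h differentiable at x"
    unfolding h by (intro allI differentiable_add d schwartz_fun_differentiable fg)
  moreover have "\<exists>C. \<forall>x. norm x ^ m * norm (h x) \<le> C" for m
    unfolding h
  proof (rule decay_add[OF schwartz_fun_decay[OF fg(1)]])
    obtain C where C: "\<And>x. norm x ^ Suc m * norm (g x) \<le> C"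
      using schwartz_fun_decay[OF fg(2)] by blast
    have "norm x ^ m * norm (complex_of_real (x $ k) * g x) \<le> C" for x
    proof -
      have "norm x ^ m * norm (complex_of_real (x $ k) * g x) \<le> norm x ^ m * (norm x * norm (g x))"
        using component_le_norm_cart[of x k]
        by (intro mult_left_mono) (simp_all add: norm_mult mult_right_mono)
      also have "\<dots> \<le> C"
        using C[of x] by (simp add: mult_ac)
      finally show ?thesis .
    qed
    then show "\<exists>C. \<forall>x. norm x ^ m * norm (complex_of_real (x $ k) * g x) \<le> C" by blast
  qed
  ultimately show "(\<forall>x. h differentiable at x) \<and> (\<forall>m. \<exists>C. \<forall>x. norm x ^ m * norm (h x) \<le> C) \<and>
      (\<forall>j. \<exists>f g. schwartz_fun f \<and> schwartz_fun g \<and>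
        partial_deriv j h = (\<lambda>x. f x + complex_of_real (x $ k) * g x))"
    by blast
qed (use assms in blast)

lemma schwartz_fun_coord:
  "schwartz_fun f \<Longrightarrow> schwartz_fun (\<lambda>x. complex_of_real (x $ k) * f x)"
  using schwartz_fun_coord_affine[OF schwartz_fun_zero, of f k] by simp

lemma partial_deriv_cmult:
  assumes "f differentiable at x"
  shows "partial_deriv k (\<lambda>x. c * f x) x = c * partial_deriv k f x"
  using partial_deriv_mult[OF differentiable_const assms, of k c]
  by (simp add: partial_deriv_def frechet_derivative_const)

lemma schwartz_fun_cmult:
  assumes "schwartz_fun f"
  shows "schwartz_fun (\<lambda>x. c * f x)"
proof (rule schwartz_fun_coinduct[of "\<lambda>h. \<exists>f. schwartz_fun f \<and> h = (\<lambda>x. c * f x)"])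
  fix h :: "real ^ 'n \<Rightarrow> complex"
  assume "\<exists>f. schwartz_fun f \<and> h = (\<lambda>x. c * f x)"
  then obtain f where f: "schwartz_fun f" and h: "h = (\<lambda>x. c * f x)" by blast
  have "partial_deriv k h = (\<lambda>x. c * partial_deriv k f x)" for k
    unfolding h by (intro ext partial_deriv_cmult schwartz_fun_differentiable f)
  moreover have "\<exists>C. \<forall>x. norm x ^ m * norm (h x) \<le> C" for m
  proof -
    obtain C where "\<And>x. norm x ^ m * norm (f x) \<le> C"
      using schwartz_fun_decay[OF f] by blast
    then have "norm x ^ m * norm (h x) \<le> norm c * C" for x
      using mult_left_mono[of "norm x ^ m * norm (f x)" C "norm c"]
      by (simp add: h norm_mult mult_ac)
    then show ?thesis by blast
  qed
  moreover have "\<forall>x. h differentiable at x"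
    using f unfolding h
    by (intro allI differentiable_mult differentiable_const schwartz_fun_differentiable)
  ultimately show "(\<forall>x. h differentiable at x) \<and> (\<forall>m. \<exists>C. \<forall>x. norm x ^ m * norm (h x) \<le> C) \<and>
      (\<forall>k. \<exists>f. schwartz_fun f \<and> partial_deriv k h = (\<lambda>x. c * f x))"
    using schwartz_fun_partial[OF f] by blast
qed (use assms in blast)

lemma schwartz_fun_continuous: "schwartz_fun f \<Longrightarrow> continuous_on UNIV f"
  by (simp add: schwartz_fun_differentiable differentiable_imp_continuous_within
      continuous_on_eq_continuous_within)

lemma schwartz_fun_measurable: "schwartz_fun f \<Longrightarrow> f \<in> borel_measurable borel"
  by (intro borel_measurable_continuous_onI schwartz_fun_continuous)

lemma schwartz_fun_moment_integrable:
  fixes f :: "real ^ 'n::finite \<Rightarrow> complex"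
  assumes "schwartz_fun f"
  shows "integrable lborel (\<lambda>x. norm x ^ m * norm (f x))"
proof -
  let ?n = "CARD('n)"
  let ?w = "\<lambda>x :: real ^ 'n. \<Prod>b\<in>Basis. inverse (1 + (x \<bullet> b)\<^sup>2)"
  define u where "u x = norm x ^ m * norm (f x)" for x
  have u: "u x \<ge> 0" for x
    by (simp add: u_def)
  obtain C where C: "C \<ge> 0" "\<And>x. norm x ^ m * norm (f x) \<le> C"
    using schwartz_fun_decayE[OF assms] by blast
  obtain D where D: "D \<ge> 0" "\<And>x. norm x ^ (2 * ?n + m) * norm (f x) \<le> D"
    using schwartz_fun_decayE[OF assms] by blast
  have bound: "u x \<le> 2 ^ ?n * (C + D) * ?w x" for x
  proof -
    have "(\<Prod>b\<in>Basis. 1 + (x \<bullet> b)\<^sup>2) \<le> (\<Prod>b\<in>(Basis :: (real ^ 'n) set). 1 + (norm x)\<^sup>2)"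
      by (intro prod_mono conjI) (auto simp: abs_le_square_iff[symmetric] Basis_le_norm)
    also have "\<dots> = (1 + (norm x)\<^sup>2) ^ ?n"
      by simp
    also have "\<dots> \<le> (2 * max 1 ((norm x)\<^sup>2)) ^ ?n"
      by (intro power_mono) auto
    also have "\<dots> \<le> 2 ^ ?n * (1 + norm x ^ (2 * ?n))"
      by (auto simp: power_mult_distrib power_mult[symmetric] max_def)
    finally have "(\<Prod>b\<in>Basis. 1 + (x \<bullet> b)\<^sup>2) * u x \<le> 2 ^ ?n * (1 + norm x ^ (2 * ?n)) * u x"
      using u by (intro mult_right_mono) auto
    also have "\<dots> \<le> 2 ^ ?n * (C + D)"
      using C(2)[of x] D(2)[of x] by (simp add: u_def power_add mult.assoc distrib_right)
    finally have "(\<Prod>b\<in>Basis. 1 + (x \<bullet> b)\<^sup>2) * u x \<le> 2 ^ ?n * (C + D)" .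
    moreover have "(\<Prod>b\<in>Basis. 1 + (x \<bullet> b)\<^sup>2) > 0"
      by (intro prod_pos) (auto intro: add_pos_nonneg)
    moreover have "?w x = inverse (\<Prod>b\<in>Basis. 1 + (x \<bullet> b)\<^sup>2)"
      using prod_inversef[of "\<lambda>b. 1 + (x \<bullet> b)\<^sup>2"] by (simp add: comp_def)
    ultimately show ?thesis
      by (simp only: divide_inverse[symmetric] pos_le_divide_eq mult.commute)
  qed
  have "integrable lborel (\<lambda>t::real. inverse (1 + t\<^sup>2))"
    using integrable_inverse_1_plus_square by (simp add: set_integrable_def)
  then have "(\<integral>\<^sup>+ t. ennreal (inverse (1 + (t::real)\<^sup>2)) \<partial>lborel) < \<infinity>"
    by (simp add: integrable_iff_bounded)
  then have "(\<Prod>b\<in>(Basis :: (real ^ 'n) set).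
      \<integral>\<^sup>+ t. ennreal (inverse (1 + (t::real)\<^sup>2)) \<partial>lborel) < \<infinity>"
    by (simp add: power_less_top_ennreal)
  moreover have "(\<integral>\<^sup>+ x. (\<Prod>b\<in>Basis. ennreal (inverse (1 + ((x :: real ^ 'n) \<bullet> b)\<^sup>2))) \<partial>lborel) =
      (\<Prod>b\<in>(Basis :: (real ^ 'n) set). \<integral>\<^sup>+ t. ennreal (inverse (1 + (t::real)\<^sup>2)) \<partial>lborel)"
    by (rule nn_integral_lborel_prod[of "\<lambda>_ t. ennreal (inverse (1 + t\<^sup>2))"]) auto
  ultimately have "(\<integral>\<^sup>+ x. ennreal (?w x) \<partial>lborel) < \<infinity>"
    by (simp add: prod_ennreal)
  then have "integrable lborel ?w"
    by (simp add: integrable_iff_bounded prod_nonneg)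
  then have "integrable lborel (\<lambda>x. 2 ^ ?n * (C + D) * ?w x)"
    by simp
  moreover have "u \<in> borel_measurable lborel"
    using schwartz_fun_measurable[OF assms] unfolding u_def by measurable
  ultimately have "integrable lborel u"
    by (rule Bochner_Integration.integrable_bound)
      (use bound u in \<open>auto intro: order_trans[OF _ abs_ge_self]\<close>)
  then show ?thesis
    by (simp add: u_def[abs_def])
qed

lemma schwartz_fun_integrable:
  assumes "schwartz_fun f"
  shows "integrable lborel f"
  using schwartz_fun_moment_integrable[OF assms, of 0] schwartz_fun_measurable[OF assms]
  by (simp add: integrable_norm_iff)

lemma schwartz_fun_lipschitz:
  fixes g :: "real ^ 'n::finite \<Rightarrow> complex"
  assumes "schwartz_fun g"
  obtains L where "L \<ge> 0" "\<And>w z. norm (g w - g z) \<le> L * norm (w - z)"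
proof -
  have "\<exists>C\<ge>0. \<forall>x. norm (partial_deriv k g x) \<le> C" for k
    using schwartz_fun_decayE[OF schwartz_fun_partial[OF assms, of k], where m = 0]
    by (metis mult_1 power_0)
  then obtain C where C: "\<And>k. C k \<ge> 0" "\<And>k x. norm (partial_deriv k g x) \<le> C k"
    by metis
  define L where "L = (\<Sum>k\<in>UNIV. C k)"
  have "norm (\<Sum>k\<in>UNIV. h $ k *\<^sub>R partial_deriv k g x) \<le> L * norm h" for h x
  proof -
    have "norm (\<Sum>k\<in>UNIV. h $ k *\<^sub>R partial_deriv k g x) \<le> (\<Sum>k\<in>UNIV. norm h * C k)"
      by (intro sum_norm_le)
        (use C component_le_norm_cart in \<open>auto intro!: mult_mono\<close>)
    then show ?thesis by (simp only: L_def sum_distrib_right mult.commute[of "norm h"])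
  qed
  then have "norm (g w - g z) \<le> L * norm (w - z)" for w z
    by (intro differentiable_bound[of UNIV g "\<lambda>x h. \<Sum>k\<in>UNIV. h $ k *\<^sub>R partial_deriv k g x"]
        onorm_bound has_derivative_partial schwartz_fun_differentiable assms)
      (auto simp: L_def C sum_nonneg)
  moreover have "L \<ge> 0"
    by (simp add: L_def C sum_nonneg)
  ultimately show ?thesis by (rule that[rotated])
qed

lemma schwartz_fun_taylor:
  fixes g :: "real ^ 'n::finite \<Rightarrow> complex"
  assumes "schwartz_fun g"
  obtains M where "M \<ge> 0"
    "\<And>z h. norm (g (z + h) - g z - (\<Sum>k\<in>UNIV. h $ k *\<^sub>R partial_deriv k g z)) \<le> M * norm h * norm h"
proof -
  have "\<exists>L\<ge>0. \<forall>w z. norm (partial_deriv k g w - partial_deriv k g z) \<le> L * norm (w - z)" for k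
    using schwartz_fun_lipschitz[OF schwartz_fun_partial[OF assms, of k]] by metis
  then obtain L where L: "\<And>k. L k \<ge> 0"
    "\<And>k w z. norm (partial_deriv k g w - partial_deriv k g z) \<le> L k * norm (w - z)"
    by metis
  define M where "M = (\<Sum>k\<in>UNIV. L k)"
  have M: "M \<ge> 0"
    by (simp add: M_def L sum_nonneg)
  have "norm (g (z + h) - g z - (\<Sum>k\<in>UNIV. h $ k *\<^sub>R partial_deriv k g z)) \<le> M * norm h * norm h" for z h
  proof -
    define F where "F w = g w - (\<Sum>k\<in>UNIV. w $ k *\<^sub>R partial_deriv k g z)" for w
    define F' where "F' w v = (\<Sum>k\<in>UNIV. v $ k *\<^sub>R partial_deriv k g w) -
      (\<Sum>k\<in>UNIV. v $ k *\<^sub>R partial_deriv k g z)" for w v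
    have lin: "bounded_linear (\<lambda>w. \<Sum>k\<in>UNIV. w $ k *\<^sub>R partial_deriv k g z)"
      by (intro bounded_linear_sum bounded_linear_scaleR_const bounded_linear_vec_nth)
    have "norm (F (z + h) - F z) \<le> (M * norm h) * norm (z + h - z)"
    proof (rule differentiable_bound)
      show "convex (cball z (norm h))" by simp
      show "(F has_derivative F' w) (at w within cball z (norm h))" for w
        unfolding F_def F'_def
        by (rule has_derivative_at_withinI[OF has_derivative_diff[OF
              has_derivative_partial[OF schwartz_fun_differentiable[OF assms]]
              bounded_linear_imp_has_derivative[OF lin]]])
      show "onorm (F' w) \<le> M * norm h" if "w \<in> cball z (norm h)" for w
      proof (rule onorm_bound)
        fix v
        have "norm (F' w v) = norm (\<Sum>k\<in>UNIV. v $ k *\<^sub>R (partial_deriv k g w - partial_deriv k g z))"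
          by (simp add: F'_def sum_subtractf scaleR_diff_right)
        also have "\<dots> \<le> (\<Sum>k\<in>UNIV. norm v * (L k * norm h))"
        proof (rule sum_norm_le)
          fix k
          have "norm (partial_deriv k g w - partial_deriv k g z) \<le> L k * norm h"
            using order_trans[OF L(2)[of k w z] mult_left_mono[OF _ L(1)[of k]]] that
            by (simp add: dist_norm norm_minus_commute)
          then show "norm (v $ k *\<^sub>R (partial_deriv k g w - partial_deriv k g z)) \<le> norm v * (L k * norm h)"
            using component_le_norm_cart[of v k] by (auto intro!: mult_mono)
        qed
        finally show "norm (F' w v) \<le> M * norm h * norm v"
          by (simp add: M_def sum_distrib_left sum_distrib_right mult_ac)
      qed (simp add: M)
    qed (auto simp: dist_norm)
    also have "F (z + h) - F z = g (z + h) - g z - (\<Sum>k\<in>UNIV. h $ k *\<^sub>R partial_deriv k g z)"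
      by (simp add: F_def scaleR_add_left sum.distrib)
    finally show ?thesis by simp
  qed
  then show ?thesis using M by (rule that[rotated])
qed

definition conv_fun :: "(real ^ 'n::finite \<Rightarrow> complex) \<Rightarrow> (real ^ 'n \<Rightarrow> complex) \<Rightarrow> real ^ 'n \<Rightarrow> complex"
  where "conv_fun f g x = (\<integral>y. f y * g (x - y) \<partial>lborel)"

lemma convolution_integrable:
  assumes "schwartz_fun f" "schwartz_fun g"
  shows "integrable lborel (\<lambda>y. f y * g (x - y))"
proof -
  obtain C where C: "\<And>x. norm (g x) \<le> C"
    using schwartz_fun_decay[OF assms(2), of 0] by auto
  have [measurable]: "f \<in> borel_measurable borel" "g \<in> borel_measurable borel"
    using assms by (auto intro: schwartz_fun_measurable)
  have "integrable lborel (\<lambda>y. C * norm (f y))"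
    using schwartz_fun_integrable[OF assms(1)] by auto
  then show ?thesis
  proof (rule Bochner_Integration.integrable_bound)
    have "norm (f y * g (x - y)) \<le> norm (C * norm (f y))" for y
    proof -
      have "norm (f y * g (x - y)) \<le> norm (f y) * C"
        using C by (simp add: norm_mult mult_left_mono)
      then show ?thesis
        by (smt (verit) mult.commute real_norm_def)
    qed
    then show "AE y in lborel. norm (f y * g (x - y)) \<le> norm (C * norm (f y))" by simp
  qed simp
qed

lemma convolution_has_derivative:
  assumes f: "schwartz_fun f" and g: "schwartz_fun g"
  shows "(conv_fun f g has_derivative
    (\<lambda>h. \<Sum>k\<in>UNIV. h $ k *\<^sub>R conv_fun f (partial_deriv k g) x)) (at x)"
proof -
  obtain M where M: "M \<ge> 0"
    "\<And>z h. norm (g (z + h) - g z - (\<Sum>k\<in>UNIV. h $ k *\<^sub>R partial_deriv k g z)) \<le> M * norm h * norm h"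
    using schwartz_fun_taylor[OF g] by blast
  note I = convolution_integrable[OF f g] convolution_integrable[OF f schwartz_fun_partial[OF g]]
  have intf: "integrable lborel (\<lambda>y. norm (f y))"
    using schwartz_fun_integrable[OF f] by auto
  define N where "N = (\<integral>y. norm (f y) \<partial>lborel) * M"
  let ?D = "\<lambda>h. \<Sum>k\<in>UNIV. h $ k *\<^sub>R conv_fun f (partial_deriv k g) x"
  have *: "norm (conv_fun f g (x + h) - conv_fun f g x - ?D h) \<le> N * norm h * norm h" for h
  proof -
    let ?R = "\<lambda>y. g ((x - y) + h) - g (x - y) - (\<Sum>k\<in>UNIV. h $ k *\<^sub>R partial_deriv k g (x - y))"
    have eq: "(\<lambda>y. f y * ?R y) = (\<lambda>y. f y * g (x + h - y) - f y * g (x - y) -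
        (\<Sum>k\<in>UNIV. h $ k *\<^sub>R (f y * partial_deriv k g (x - y))))"
      by (simp add: fun_eq_iff right_diff_distrib sum_distrib_left algebra_simps)
    have intR: "integrable lborel (\<lambda>y. f y * ?R y)"
      unfolding eq using I by auto
    have "conv_fun f g (x + h) - conv_fun f g x - ?D h = (\<integral>y. f y * ?R y \<partial>lborel)"
      unfolding eq conv_fun_def using I by simp
    then have "norm (conv_fun f g (x + h) - conv_fun f g x - ?D h) \<le> (\<integral>y. norm (f y * ?R y) \<partial>lborel)"
      by (simp only: integral_norm_bound)
    also have "\<dots> \<le> (\<integral>y. norm (f y) * (M * norm h * norm h) \<partial>lborel)"
      by (intro integral_mono integrable_norm intR integrable_mult_left intf)
        (use M in \<open>simp add: norm_mult mult_left_mono\<close>)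
    also have "\<dots> = N * norm h * norm h"
      by (simp add: N_def)
    finally show ?thesis .
  qed
  have lin: "bounded_linear ?D"
    by (intro bounded_linear_sum bounded_linear_scaleR_const bounded_linear_vec_nth)
  show ?thesis
    unfolding has_derivative_at
  proof (intro conjI lin)
    show "(\<lambda>h. norm (conv_fun f g (x + h) - conv_fun f g x - ?D h) / norm h) \<midarrow>0\<rightarrow> 0"
    proof (rule tendsto_sandwich[of "\<lambda>_. 0"])
      show "(\<lambda>h. N * norm h) \<midarrow>0\<rightarrow> 0"
        by (auto intro!: tendsto_eq_intros)
      show "\<forall>\<^sub>F h in at 0. norm (conv_fun f g (x + h) - conv_fun f g x - ?D h) / norm h \<le> N * norm h"
        using * by (auto simp: eventually_at_filter divide_simps)
    qed auto
  qed
qed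

lemma partial_deriv_convolution:
  assumes "schwartz_fun f" "schwartz_fun g"
  shows "partial_deriv k (conv_fun f g) = conv_fun f (partial_deriv k g)"
proof
  fix x
  have "(\<Sum>j\<in>UNIV. axis k 1 $ j *\<^sub>R conv_fun f (partial_deriv j g) x) =
      (\<Sum>j\<in>UNIV. if j = k then conv_fun f (partial_deriv j g) x else 0)"
    by (intro sum.cong) (auto simp: axis_def)
  then show "partial_deriv k (conv_fun f g) x = conv_fun f (partial_deriv k g) x"
    by (simp add: partial_deriv_eq[OF convolution_has_derivative[OF assms]])
qed

lemma convolution_decay:
  assumes f: "schwartz_fun f" and g: "schwartz_fun g"
  shows "\<exists>C. \<forall>x. norm x ^ m * norm (conv_fun f g x) \<le> C"
proof -
  obtain C where C: "C \<ge> 0" "\<And>x. norm x ^ 0 * norm (g x) \<le> C"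
    using schwartz_fun_decayE[OF g] by blast
  obtain D where D: "D \<ge> 0" "\<And>x. norm x ^ m * norm (g x) \<le> D"
    using schwartz_fun_decayE[OF g] by blast
  let ?b = "\<lambda>y. 2 ^ m * (C * (norm y ^ m * norm (f y)) + D * (norm y ^ 0 * norm (f y)))"
  have b: "integrable lborel ?b"
    by (intro integrable_mult_right Bochner_Integration.integrable_add
        schwartz_fun_moment_integrable f)
  have "norm x ^ m * norm (conv_fun f g x) \<le> (\<integral>y. ?b y \<partial>lborel)" for x
  proof -
    have I: "integrable lborel (\<lambda>y. norm (f y * g (x - y)))"
      using convolution_integrable[OF f g] by (rule integrable_norm)
    have "norm x ^ m * norm (conv_fun f g x) \<le> norm x ^ m * (\<integral>y. norm (f y * g (x - y)) \<partial>lborel)"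
      unfolding conv_fun_def by (intro mult_left_mono integral_norm_bound) simp
    also have "\<dots> = (\<integral>y. norm x ^ m * norm (f y * g (x - y)) \<partial>lborel)"
      by simp
    also have "\<dots> \<le> (\<integral>y. ?b y \<partial>lborel)"
    proof (rule integral_mono)
      fix y
      have "norm x \<le> norm y + norm (x - y)"
        using norm_triangle_ineq[of y "x - y"] by simp
      also have "\<dots> \<le> 2 * max (norm y) (norm (x - y))"
        by simp
      finally have "norm x ^ m \<le> (2 * max (norm y) (norm (x - y))) ^ m"
        by (intro power_mono) auto
      also have "\<dots> \<le> 2 ^ m * (norm y ^ m + norm (x - y) ^ m)"
        by (auto simp: power_mult_distrib max_def)
      finally have "norm x ^ m * norm (f y * g (x - y)) \<le>
          2 ^ m * (norm y ^ m + norm (x - y) ^ m) * norm (f y * g (x - y))"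
        by (rule mult_right_mono) simp
      also have "\<dots> = 2 ^ m * ((norm y ^ m * norm (f y)) * norm (g (x - y)) +
          norm (f y) * (norm (x - y) ^ m * norm (g (x - y))))"
        by (simp add: norm_mult algebra_simps)
      also have "\<dots> \<le> 2 ^ m * ((norm y ^ m * norm (f y)) * C + norm (f y) * D)"
        using C(2)[of "x - y"] D(2)[of "x - y"]
        by (intro mult_left_mono add_mono) simp_all
      finally show "norm x ^ m * norm (f y * g (x - y)) \<le> ?b y"
        by (simp add: mult_ac)
    qed (use I b in auto)
    finally show ?thesis .
  qed
  then show ?thesis by blast
qed

lemma schwartz_fun_convolution:
  assumes "schwartz_fun f" "schwartz_fun g"
  shows "schwartz_fun (conv_fun f g)"
proof (rule schwartz_fun_coinduct[of "\<lambda>h. \<exists>g. schwartz_fun g \<and> h = conv_fun f g"])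
  fix h
  assume "\<exists>g. schwartz_fun g \<and> h = conv_fun f g"
  then obtain g where g: "schwartz_fun g" and h: "h = conv_fun f g" by blast
  have "\<forall>x. h differentiable at x"
    using convolution_has_derivative[OF assms(1) g] unfolding h differentiable_def by blast
  then show "(\<forall>x. h differentiable at x) \<and> (\<forall>m. \<exists>C. \<forall>x. norm x ^ m * norm (h x) \<le> C) \<and>
      (\<forall>k. \<exists>g. schwartz_fun g \<and> partial_deriv k h = conv_fun f g)"
    using g assms(1) convolution_decay partial_deriv_convolution schwartz_fun_partial
    unfolding h by metis
qed (use assms in blast)

lemma foldr_partial_deriv_add:
  assumes "schwartz_fun f" "schwartz_fun g"
  shows "foldr partial_deriv ks (\<lambda>x. f x + g x) =
    (\<lambda>x. foldr partial_deriv ks f x + foldr partial_deriv ks g x)"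
proof (induction ks)
  case (Cons k ks)
  have "foldr partial_deriv ks f differentiable at x" "foldr partial_deriv ks g differentiable at x" for x
    using assms by (simp_all add: schwartz_fun_def)
  then show ?case
    by (simp add: Cons fun_eq_iff partial_deriv_add)
qed simp

lemma foldr_partial_deriv_coord_bound:
  assumes "schwartz_fun f"
    and "\<And>l js x. l \<le> Suc m \<Longrightarrow> length js \<le> length ks \<Longrightarrow>
      norm x ^ l * norm (foldr partial_deriv js f x) \<le> e"
  shows "norm x ^ m * norm (foldr partial_deriv ks (\<lambda>x. complex_of_real (x $ k) * f x) x)
    \<le> (1 + real (length ks)) * e"
  using assms
proof (induction ks arbitrary: f rule: rev_induct)
  case Nil
  have "norm x ^ m * norm (complex_of_real (x $ k) * f x) \<le> norm x ^ m * (norm x * norm (f x))"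
    using component_le_norm_cart[of x k]
    by (intro mult_left_mono) (simp_all add: norm_mult mult_right_mono)
  also have "\<dots> \<le> e"
    using Nil(2)[of "Suc m" "[]" x] by (simp add: mult_ac)
  finally show ?case by simp
next
  case (snoc j ks)
  let ?d = "\<lambda>x. if j = k then f x else 0"
  have "partial_deriv j (\<lambda>x. complex_of_real (x $ k) * f x) =
      (\<lambda>x. ?d x + complex_of_real (x $ k) * partial_deriv j f x)"
    by (rule ext) (simp add: partial_deriv_mult schwartz_fun_differentiable snoc.prems(1)
        coord_differentiable partial_deriv_coord)
  moreover have "schwartz_fun ?d"
    using snoc.prems(1) by (cases "j = k") (simp_all add: schwartz_fun_zero)
  ultimately have eq: "foldr partial_deriv (ks @ [j]) (\<lambda>x. complex_of_real (x $ k) * f x) x =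
      foldr partial_deriv ks ?d x +
      foldr partial_deriv ks (\<lambda>x. complex_of_real (x $ k) * partial_deriv j f x) x"
    by (simp add: foldr_partial_deriv_add schwartz_fun_coord schwartz_fun_partial snoc.prems(1))
  have e: "e \<ge> 0"
    using snoc.prems(2)[of 0 "[]" x] by (simp add: order_trans[OF norm_ge_zero])
  have "foldr partial_deriv ks (\<lambda>_. 0) = (\<lambda>_. 0)"
    by (induction ks) (auto simp: partial_deriv_def frechet_derivative_const)
  then have 1: "norm x ^ m * norm (foldr partial_deriv ks ?d x) \<le> e"
    using snoc.prems(2)[of m ks x] e by (cases "j = k") simp_all
  have 2: "norm x ^ m * norm (foldr partial_deriv ks (\<lambda>x. complex_of_real (x $ k) * partial_deriv j f x) x)
      \<le> (1 + real (length ks)) * e"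
  proof (rule snoc.IH)
    show "norm x ^ l * norm (foldr partial_deriv js (partial_deriv j f) x) \<le> e"
      if "l \<le> Suc m" "length js \<le> length ks" for l js x
      using snoc.prems(2)[of l "js @ [j]" x] that by simp
  qed (intro schwartz_fun_partial snoc.prems)
  have "norm x ^ m * norm (foldr partial_deriv (ks @ [j]) (\<lambda>x. complex_of_real (x $ k) * f x) x)
      \<le> norm x ^ m * (norm (foldr partial_deriv ks ?d x) +
        norm (foldr partial_deriv ks (\<lambda>x. complex_of_real (x $ k) * partial_deriv j f x) x))"
    unfolding eq by (intro mult_left_mono norm_triangle_ineq) simp
  also have "\<dots> \<le> (1 + real (length (ks @ [j]))) * e"
    using 1 2 by (simp add: distrib_left distrib_right)
  finally show ?case .
qed

section \<open>The Schwartz space and tempered distributions\<close>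

typedef 'n schwartz = "{f :: real ^ 'n::finite \<Rightarrow> complex. schwartz_fun f}"
  morphisms schwartz_apply Schwartz
  by (rule exI[of _ "\<lambda>_. 0"]) (simp add: schwartz_fun_zero)

setup_lifting type_definition_schwartz

instantiation schwartz :: (finite) complex_vector
begin
lift_definition zero_schwartz :: "'a schwartz" is "\<lambda>_. 0"
  by (rule schwartz_fun_zero)
lift_definition plus_schwartz :: "'a schwartz \<Rightarrow> 'a schwartz \<Rightarrow> 'a schwartz" is "\<lambda>f g x. f x + g x"
  by (rule schwartz_fun_add)
lift_definition scaleC_schwartz :: "complex \<Rightarrow> 'a schwartz \<Rightarrow> 'a schwartz" is "\<lambda>c f x. c * f x"
  by (rule schwartz_fun_cmult)
lift_definition uminus_schwartz :: "'a schwartz \<Rightarrow> 'a schwartz" is "\<lambda>f x. - f x"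
  using schwartz_fun_cmult[of _ "-1"] by simp
lift_definition minus_schwartz :: "'a schwartz \<Rightarrow> 'a schwartz \<Rightarrow> 'a schwartz" is "\<lambda>f g x. f x - g x"
  subgoal for f g
    using schwartz_fun_add[of f "\<lambda>x. -1 * g x"] schwartz_fun_cmult[of g "-1"] by simp
  done
instance
  by standard (transfer, simp add: fun_eq_iff algebra_simps)+
end

definition schwartz_seminorm :: "nat \<Rightarrow> 'n::finite list \<Rightarrow> 'n schwartz \<Rightarrow> real"
  where "schwartz_seminorm m ks f =
    (SUP x. norm x ^ m * norm (foldr partial_deriv ks (schwartz_apply f) x))"

instantiation schwartz :: (finite) topological_space
begin
definition open_schwartz :: "'a schwartz set \<Rightarrow> bool"
  where "open_schwartz U \<longleftrightarrow> (\<forall>f\<in>U. \<exists>N. \<exists>e>0. \<forall>g.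
    (\<forall>m\<le>N. \<forall>ks. length ks \<le> N \<longrightarrow> schwartz_seminorm m ks (g - f) < e) \<longrightarrow> g \<in> U)"
instance
proof
  show "open (UNIV :: 'a schwartz set)"
    unfolding open_schwartz_def by (auto intro: exI[of _ "1::real"])
  show "open (S \<inter> T)" if ST: "open S" "open T" for S T :: "'a schwartz set"
    unfolding open_schwartz_def
  proof
    fix f assume "f \<in> S \<inter> T"
    then have f: "f \<in> S" "f \<in> T" by auto
    obtain N d where 1: "d > 0"
      "\<And>g. (\<forall>m\<le>N. \<forall>ks. length ks \<le> N \<longrightarrow> schwartz_seminorm m ks (g - f) < d) \<Longrightarrow> g \<in> S"
      using ST(1) f(1) unfolding open_schwartz_def by metis
    obtain M e where 2: "e > 0"
      "\<And>g. (\<forall>m\<le>M. \<forall>ks. length ks \<le> M \<longrightarrow> schwartz_seminorm m ks (g - f) < e) \<Longrightarrow> g \<in> T"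
      using ST(2) f(2) unfolding open_schwartz_def by metis
    show "\<exists>N. \<exists>e>0. \<forall>g. (\<forall>m\<le>N. \<forall>ks. length ks \<le> N \<longrightarrow> schwartz_seminorm m ks (g - f) < e) \<longrightarrow> g \<in> S \<inter> T"
      by (rule exI[of _ "max N M"], rule exI[of _ "min d e"]) (use 1 2 in auto)
  qed
  show "open (\<Union>K)" if "\<forall>S\<in>K. open S" for K :: "'a schwartz set set"
    using that unfolding open_schwartz_def by (meson Union_iff)
qed
end

lemma schwartz_seminorm_bdd:
  "bdd_above (range (\<lambda>x. norm x ^ m * norm (foldr partial_deriv ks (schwartz_apply f) x)))"
  using schwartz_apply[of f] unfolding schwartz_fun_def bdd_above_def by fast

lemma schwartz_seminorm_upper:
  "norm x ^ m * norm (foldr partial_deriv ks (schwartz_apply f) x) \<le> schwartz_seminorm m ks f"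
  unfolding schwartz_seminorm_def by (rule cSUP_upper[OF UNIV_I schwartz_seminorm_bdd])

lemma schwartz_seminorm_least:
  "(\<And>x. norm x ^ m * norm (foldr partial_deriv ks (schwartz_apply f) x) \<le> e) \<Longrightarrow>
    schwartz_seminorm m ks f \<le> e"
  unfolding schwartz_seminorm_def by (rule cSUP_least) auto

lemma schwartz_continuousI:
  fixes Z :: "('n::finite schwartz, 'n schwartz) clinmap"
  assumes "\<And>N. \<exists>M C. C > 0 \<and> (\<forall>f e. (\<forall>m\<le>M. \<forall>ks. length ks \<le> M \<longrightarrow> schwartz_seminorm m ks f \<le> e) \<longrightarrow>
    (\<forall>m\<le>N. \<forall>ks. length ks \<le> N \<longrightarrow> schwartz_seminorm m ks (Z \<cdot> f) \<le> C * e))"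
  shows "continuous_on UNIV (clinmap_apply Z)"
  unfolding continuous_on_open_vimage[OF open_UNIV]
proof (intro allI impI)
  fix U :: "'n schwartz set" assume U: "open U"
  have "open (clinmap_apply Z -` U)"
    unfolding open_schwartz_def
  proof
    fix f assume "f \<in> clinmap_apply Z -` U"
    then obtain N e where e: "e > 0"
      "\<And>g. (\<forall>m\<le>N. \<forall>ks. length ks \<le> N \<longrightarrow> schwartz_seminorm m ks (g - Z \<cdot> f) < e) \<Longrightarrow> g \<in> U"
      using U unfolding open_schwartz_def by (metis vimageD)
    obtain M C where C: "C > 0"
      "\<And>f e m ks. (\<forall>m\<le>M. \<forall>ks. length ks \<le> M \<longrightarrow> schwartz_seminorm m ks f \<le> e) \<Longrightarrow>
        m \<le> N \<Longrightarrow> length ks \<le> N \<Longrightarrow> schwartz_seminorm m ks (Z \<cdot> f) \<le> C * e"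
      using assms[of N] by blast
    have "g \<in> clinmap_apply Z -` U"
      if g: "\<forall>m\<le>M. \<forall>ks. length ks \<le> M \<longrightarrow> schwartz_seminorm m ks (g - f) < e / (2 * C)" for g
    proof -
      have "schwartz_seminorm m ks (Z \<cdot> g - Z \<cdot> f) < e" if "m \<le> N" "length ks \<le> N" for m ks
      proof -
        have "schwartz_seminorm m ks (Z \<cdot> (g - f)) \<le> C * (e / (2 * C))"
          by (rule C(2)[OF _ that]) (use g in \<open>auto intro: less_imp_le\<close>)
        also have "\<dots> < e"
          using C(1) e(1) by simp
        finally show ?thesis by (simp add: clinmap_diff)
      qed
      then show ?thesis using e(2) by simp
    qed
    then show "\<exists>N. \<exists>e>0. \<forall>g. (\<forall>m\<le>N. \<forall>ks. length ks \<le> N \<longrightarrow> schwartz_seminorm m ks (g - f) < e) \<longrightarrow>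
        g \<in> clinmap_apply Z -` U"
      using C(1) e(1) by (intro exI[of _ M] exI[of _ "e / (2 * C)"]) simp
  qed
  then show "open (clinmap_apply Z -` U \<inter> UNIV)" by simp
qed

lift_definition coord_mult :: "'n::finite \<Rightarrow> 'n schwartz \<Rightarrow> 'n schwartz"
  is "\<lambda>k f x. complex_of_real (x $ k) * f x"
  by (rule schwartz_fun_coord)

lift_definition D_op :: "'n::finite \<Rightarrow> 'n schwartz \<Rightarrow> 'n schwartz"
  is "\<lambda>k f x. (1 / \<i>) * partial_deriv k f x"
  by (intro schwartz_fun_cmult schwartz_fun_partial)

lift_definition schwartz_coord :: "'n::finite \<Rightarrow> ('n schwartz, 'n schwartz) clinmap" is coord_mult
  unfolding clinear_iff by (intro conjI allI; transfer; simp add: fun_eq_iff algebra_simps)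

lift_definition schwartz_D :: "'n::finite \<Rightarrow> ('n schwartz, 'n schwartz) clinmap" is D_op
  unfolding clinear_iff
  by (intro conjI allI; transfer; simp add: fun_eq_iff algebra_simps partial_deriv_add
      partial_deriv_cmult schwartz_fun_differentiable)

lemma foldr_partial_deriv_cmult:
  assumes "schwartz_fun f"
  shows "foldr partial_deriv ks (\<lambda>x. c * f x) = (\<lambda>x. c * foldr partial_deriv ks f x)"
proof (induction ks)
  case (Cons k ks)
  have "foldr partial_deriv ks f differentiable at x" for x
    using assms by (simp add: schwartz_fun_def)
  then show ?case
    by (simp add: Cons fun_eq_iff partial_deriv_cmult)
qed simp

lemma schwartz_coord_continuous: "continuous_on UNIV (clinmap_apply (schwartz_coord k))"
proof (rule schwartz_continuousI)
  fix N
  show "\<exists>M C. C > 0 \<and> (\<forall>f e. (\<forall>m\<le>M. \<forall>ks. length ks \<le> M \<longrightarrow> schwartz_seminorm m ks f \<le> e) \<longrightarrow>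
    (\<forall>m\<le>N. \<forall>ks. length ks \<le> N \<longrightarrow> schwartz_seminorm m ks (schwartz_coord k \<cdot> f) \<le> C * e))"
  proof (intro exI[of _ "Suc N"] exI[of _ "1 + real N"] conjI allI impI)
    fix f :: "'a schwartz" and e m and ks :: "'a list"
    assume *: "\<forall>m\<le>Suc N. \<forall>ks. length ks \<le> Suc N \<longrightarrow> schwartz_seminorm m ks f \<le> e"
      and m: "m \<le> N" "length ks \<le> N"
    have b: "norm x ^ l * norm (foldr partial_deriv js (schwartz_apply f) x) \<le> e"
      if "l \<le> Suc N" "length js \<le> Suc N" for l js x
      using * that schwartz_seminorm_upper order_trans by blast
    have e: "e \<ge> 0"
      using b[of 0 "[]" 0] by (simp add: order_trans[OF norm_ge_zero])
    have eq: "schwartz_apply (schwartz_coord k \<cdot> f) = (\<lambda>x. complex_of_real (x $ k) * schwartz_apply f x)"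
      by (simp add: schwartz_coord.rep_eq coord_mult.rep_eq)
    have "schwartz_seminorm m ks (schwartz_coord k \<cdot> f) \<le> (1 + real (length ks)) * e"
      unfolding schwartz_seminorm_def eq
      by (intro cSUP_least foldr_partial_deriv_coord_bound b) (use m schwartz_apply[of f] in auto)
    also have "\<dots> \<le> (1 + real N) * e"
      using m e by (intro mult_right_mono) auto
    finally show "schwartz_seminorm m ks (schwartz_coord k \<cdot> f) \<le> (1 + real N) * e" .
  qed simp
qed

lemma schwartz_D_continuous: "continuous_on UNIV (clinmap_apply (schwartz_D k))"
proof (rule schwartz_continuousI)
  fix N
  show "\<exists>M C. C > 0 \<and> (\<forall>f e. (\<forall>m\<le>M. \<forall>ks. length ks \<le> M \<longrightarrow> schwartz_seminorm m ks f \<le> e) \<longrightarrow>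
    (\<forall>m\<le>N. \<forall>ks. length ks \<le> N \<longrightarrow> schwartz_seminorm m ks (schwartz_D k \<cdot> f) \<le> C * e))"
  proof (intro exI[of _ "Suc N"] exI[of _ 1] conjI allI impI)
    fix f :: "'a schwartz" and e m and ks :: "'a list"
    assume *: "\<forall>m\<le>Suc N. \<forall>ks. length ks \<le> Suc N \<longrightarrow> schwartz_seminorm m ks f \<le> e"
      and m: "m \<le> N" "length ks \<le> N"
    have f: "schwartz_fun (schwartz_apply f)"
      using schwartz_apply[of f] by simp
    have "foldr partial_deriv ks (schwartz_apply (schwartz_D k \<cdot> f)) =
        (\<lambda>x. (1 / \<i>) * foldr partial_deriv (ks @ [k]) (schwartz_apply f) x)"
      using foldr_partial_deriv_cmult[OF schwartz_fun_partial[OF f], of ks "1 / \<i>" k]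
      by (simp only: schwartz_D.rep_eq D_op.rep_eq foldr_append) simp
    then have "schwartz_seminorm m ks (schwartz_D k \<cdot> f) = schwartz_seminorm m (ks @ [k]) f"
      unfolding schwartz_seminorm_def by (simp only: norm_mult norm_divide norm_one norm_ii) simp
    then show "schwartz_seminorm m ks (schwartz_D k \<cdot> f) \<le> 1 * e"
      using * m by simp
  qed simp
qed

typedef 'n tempered = "{T :: 'n::finite schwartz cdual. continuous_on UNIV (clinmap_apply T)}"
  morphisms tempered_dual Tempered
  by (rule exI[of _ 0]) (simp add: zero_clinmap.rep_eq)

setup_lifting type_definition_tempered

instantiation tempered :: (finite) complex_vector
begin
lift_definition zero_tempered :: "'a tempered" is 0
  by (simp add: zero_clinmap.rep_eq)
lift_definition plus_tempered :: "'a tempered \<Rightarrow> 'a tempered \<Rightarrow> 'a tempered" is "(+)"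
  by (simp add: plus_clinmap.rep_eq continuous_on_add)
lift_definition uminus_tempered :: "'a tempered \<Rightarrow> 'a tempered" is uminus
  by (simp add: uminus_clinmap.rep_eq continuous_on_minus)
lift_definition minus_tempered :: "'a tempered \<Rightarrow> 'a tempered \<Rightarrow> 'a tempered" is "(-)"
  by (simp add: minus_clinmap.rep_eq continuous_on_diff)
lift_definition scaleC_tempered :: "complex \<Rightarrow> 'a tempered \<Rightarrow> 'a tempered" is scaleC
  by (simp add: scaleC_clinmap.rep_eq continuous_on_mult_left)
instance
  by standard (transfer, simp add: scaleC_add_right scaleC_add_left)+
end

lift_definition tempered_inclusion :: "('n::finite tempered, 'n schwartz cdual) clinmap"
  is tempered_dual
  by (simp add: clinear_iff plus_tempered.rep_eq scaleC_tempered.rep_eq)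

lift_definition coord_distribution :: "'n::finite \<Rightarrow> 'n tempered \<Rightarrow> 'n tempered"
  is "\<lambda>k T. T \<circ>\<^sub>C schwartz_coord k"
  by (simp add: clinmap_compose.rep_eq continuous_on_compose2[OF _ schwartz_coord_continuous])

lift_definition D_distribution :: "'n::finite \<Rightarrow> 'n tempered \<Rightarrow> 'n tempered"
  is "\<lambda>k T. - (T \<circ>\<^sub>C schwartz_D k)"
  by (simp add: uminus_clinmap.rep_eq clinmap_compose.rep_eq
      continuous_on_minus continuous_on_compose2[OF _ schwartz_D_continuous])

lift_definition tempered_coord :: "'n::finite \<Rightarrow> ('n tempered, 'n tempered) clinmap"
  is coord_distribution
  unfolding clinear_iff by (intro conjI allI; transfer; rule clinmap_eqI; transfer; simp)

lift_definition tempered_D :: "'n::finite \<Rightarrow> ('n tempered, 'n tempered) clinmap"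
  is D_distribution
  unfolding clinear_iff by (intro conjI allI; transfer; rule clinmap_eqI; transfer; simp)

lemma tempered_coord_apply:
  "tempered_dual (tempered_coord k \<cdot> T) \<cdot> f = tempered_dual T \<cdot> (schwartz_coord k \<cdot> f)"
  by (simp add: tempered_coord.rep_eq coord_distribution.rep_eq clinmap_compose.rep_eq)

lemma tempered_D_apply:
  "tempered_dual (tempered_D k \<cdot> T) \<cdot> f = - (tempered_dual T \<cdot> (schwartz_D k \<cdot> f))"
  by (simp add: tempered_D.rep_eq D_distribution.rep_eq clinmap_compose.rep_eq uminus_clinmap.rep_eq)

section \<open>Coproducts and coderivations\<close>

lift_definition schwartz_mult :: "'n::finite schwartz \<Rightarrow> 'n schwartz \<Rightarrow> 'n schwartz"
  is "\<lambda>f g x. f x * g x"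
  by (rule schwartz_fun_mult)

lift_definition schwartz_conv :: "'n::finite schwartz \<Rightarrow> 'n schwartz \<Rightarrow> 'n schwartz"
  is conv_fun
  by (rule schwartz_fun_convolution)

lemma cbilinear_schwartz_mult: "cbilinear schwartz_mult"
  unfolding cbilinear_def clinear_iff
  by (intro conjI allI; transfer; simp add: fun_eq_iff algebra_simps)

lemma conv_fun_bilinear:
  assumes "schwartz_fun f" "schwartz_fun g" "schwartz_fun h"
  shows "conv_fun (\<lambda>x. f x + g x) h = (\<lambda>x. conv_fun f h x + conv_fun g h x)"
    "conv_fun h (\<lambda>x. f x + g x) = (\<lambda>x. conv_fun h f x + conv_fun h g x)"
    "conv_fun (\<lambda>x. c * f x) h = (\<lambda>x. c * conv_fun f h x)"
    "conv_fun h (\<lambda>x. c * f x) = (\<lambda>x. c * conv_fun h f x)"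
  using assms
  by (simp_all add: fun_eq_iff conv_fun_def convolution_integrable distrib_left distrib_right
      mult.assoc mult.left_commute[of _ c])

lemma cbilinear_schwartz_conv: "cbilinear schwartz_conv"
  unfolding cbilinear_def clinear_iff
  by (intro conjI allI; transfer; simp add: conv_fun_bilinear)

definition m_pointwise :: "('n::finite schwartz \<otimes> 'n schwartz, 'n schwartz) clinmap"
  where "m_pointwise = tensor_lift schwartz_mult"

definition m_convolution :: "('n::finite schwartz \<otimes> 'n schwartz, 'n schwartz) clinmap"
  where "m_convolution = tensor_lift schwartz_conv"

lemma m_pointwise_tmul: "m_pointwise \<cdot> (f \<otimes>\<^sub>t g) = schwartz_mult f g"
  unfolding m_pointwise_def by (rule tensor_lift_tmul[OF cbilinear_schwartz_mult])

lemma m_convolution_tmul: "m_convolution \<cdot> (f \<otimes>\<^sub>t g) = schwartz_conv f g"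
  unfolding m_convolution_def by (rule tensor_lift_tmul[OF cbilinear_schwartz_conv])

definition distribution_coproduct ::
  "('n::finite schwartz \<otimes> 'n schwartz, 'n schwartz) clinmap \<Rightarrow>
   ('n tempered, ('n schwartz \<otimes> 'n schwartz) cdual) clinmap"
  where "distribution_coproduct m = transpose_map m \<circ>\<^sub>C tempered_inclusion"

definition matrix_unit :: "'n::finite \<Rightarrow> 'n \<Rightarrow> complex ^ 'n ^ 'n"
  where "matrix_unit i j = (\<chi> a b. if a = i \<and> b = j then 1 else 0)"

lift_definition matrix_coproduct ::
  "(complex ^ 'n::finite ^ 'n, (complex ^ 'n ^ 'n) \<otimes> (complex ^ 'n ^ 'n)) clinmap"
  is "\<lambda>A. \<Sum>i\<in>UNIV. \<Sum>j\<in>UNIV. A $ i $ j *\<^sub>C (matrix_unit i j \<otimes>\<^sub>t matrix_unit i j)"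
  by (simp add: clinear_iff scaleC_vec_def scaleC_add_left sum.distrib
      complex_vector.scale_sum_right scaleC_scaleC)

lemma matrix_coproduct_unit:
  "matrix_coproduct \<cdot> matrix_unit i j = matrix_unit i j \<otimes>\<^sub>t matrix_unit i j"
proof -
  have "matrix_coproduct \<cdot> matrix_unit i j = (\<Sum>a\<in>UNIV. \<Sum>b\<in>UNIV.
      if a = i then if b = j then matrix_unit a b \<otimes>\<^sub>t matrix_unit a b else 0 else 0)"
    unfolding matrix_coproduct.rep_eq by (intro sum.cong) (auto simp: matrix_unit_def scaleC_one)
  also have "\<dots> = (\<Sum>a\<in>UNIV. if a = i then matrix_unit a j \<otimes>\<^sub>t matrix_unit a j else 0)"
    by (intro sum.cong) auto
  finally show ?thesis by simp
qed

definition coproduct_bar ::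
  "('n::finite schwartz \<otimes> 'n schwartz, 'n schwartz) clinmap \<Rightarrow>
   ('n tempered \<otimes> (complex ^ 'n ^ 'n),
    ('n schwartz \<otimes> 'n schwartz) cdual \<otimes> ((complex ^ 'n ^ 'n) \<otimes> (complex ^ 'n ^ 'n))) clinmap"
  where "coproduct_bar m = distribution_coproduct m \<otimes>\<^sub>m matrix_coproduct"

definition is_adjoint ::
  "('n::finite tempered, 'n tempered) clinmap \<Rightarrow> ('n schwartz, 'n schwartz) clinmap \<Rightarrow> bool"
  where "is_adjoint W Z \<longleftrightarrow> (\<forall>T f. tempered_dual (W \<cdot> T) \<cdot> f = tempered_dual T \<cdot> (Z \<cdot> f))"

text \<open>
  The operator \<open>V = Z\<^sup>* \<otimes> id\<close> is a coderivation with respect to \<open>coproduct_bar m\<close>.  The extensions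
  of \<open>W = Z\<^sup>*\<close> to the dual of the tensor square are the transposes of \<open>Z \<otimes> id\<close> and \<open>id \<otimes> Z\<close>, so
  the co-Leibniz rule refers to \<open>Z\<close>.  The existential quantifier involves no choice: \<open>V\<close>
  determines \<open>W\<close>, and \<open>W\<close> determines \<open>Z\<close> because tempered distributions separate Schwartz
  functions.
\<close>

definition is_coderivation ::
  "('n::finite schwartz \<otimes> 'n schwartz, 'n schwartz) clinmap \<Rightarrow>
   ('n tempered \<otimes> (complex ^ 'n ^ 'n), 'n tempered \<otimes> (complex ^ 'n ^ 'n)) clinmap \<Rightarrow> bool"
  where "is_coderivation m V \<longleftrightarrow> (\<exists>W Z. is_adjoint W Z \<and> V = W \<otimes>\<^sub>m clinmap_id \<and>
    coproduct_bar m \<circ>\<^sub>C V =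
    ((transpose_map (Z \<otimes>\<^sub>m clinmap_id) + transpose_map (clinmap_id \<otimes>\<^sub>m Z)) \<otimes>\<^sub>m clinmap_id)
      \<circ>\<^sub>C coproduct_bar m)"

end

theory Submission
  imports Defs
begin

text \<open>
  An operator that is a derivation for a product on Schwartz functions dualizes to a coderivation
  of the transposed coproduct.  Multiplication by the \<open>k\<close>-th coordinate is a derivation for
  convolution because \<open>x\<^sub>k = y\<^sub>k + (x - y)\<^sub>k\<close> under the integral; \<open>D\<^sub>k\<close> is a derivation for the
  pointwise product by the Leibniz rule.
\<close>

text \<open>Functionals on the tensor square agree once they agree on pure tensors. At
  \<open>f \<otimes>\<^sub>t g\<close> both sides become \<open>T\<close> at
  \<open>Z \<cdot> (m \<cdot> (f \<otimes>\<^sub>t g))\<close>: on the left by adjointness, on the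
  right by \<open>Leibniz\<close> and linearity of \<open>T\<close>.\<close>

lemma coproduct_coLeibniz:
  assumes adj: "is_adjoint W Z"
    and Leibniz: "\<And>f g. Z \<cdot> (m \<cdot> (f \<otimes>\<^sub>t g)) = m \<cdot> ((Z \<cdot> f) \<otimes>\<^sub>t g) + m \<cdot> (f \<otimes>\<^sub>t (Z \<cdot> g))"
  shows "distribution_coproduct m \<cdot> (W \<cdot> T) =
    (transpose_map (Z \<otimes>\<^sub>m clinmap_id) + transpose_map (clinmap_id \<otimes>\<^sub>m Z))
      \<cdot> (distribution_coproduct m \<cdot> T)"
proof (rule tensor_clinmap_eqI)
  fix f g
  show "distribution_coproduct m \<cdot> (W \<cdot> T) \<cdot> (f \<otimes>\<^sub>t g) =
    (transpose_map (Z \<otimes>\<^sub>m clinmap_id) + transpose_map (clinmap_id \<otimes>\<^sub>m Z))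
      \<cdot> (distribution_coproduct m \<cdot> T) \<cdot> (f \<otimes>\<^sub>t g)"
    using adj
    by (simp add: is_adjoint_def distribution_coproduct_def clinmap_compose.rep_eq
        transpose_map.rep_eq tempered_inclusion.rep_eq plus_clinmap.rep_eq tensor_map_tmul
        clinmap_id.rep_eq Leibniz clinmap_add)
qed

text \<open>The matrix factor is inert: on \<open>T \<otimes>\<^sub>t A\<close> both sides have
  second factor \<open>matrix_coproduct \<cdot> A\<close>, so only the first factors need
  comparing.\<close>

lemma coderivation_if_derivation:
  assumes "is_adjoint W Z"
    and "\<And>f g. Z \<cdot> (m \<cdot> (f \<otimes>\<^sub>t g)) = m \<cdot> ((Z \<cdot> f) \<otimes>\<^sub>t g) + m \<cdot> (f \<otimes>\<^sub>t (Z \<cdot> g))"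
  shows "is_coderivation m (W \<otimes>\<^sub>m clinmap_id)"
  unfolding is_coderivation_def
proof (intro exI conjI)
  \<comment> \<open>\<open>exI\<close> leaves both witnesses open. This equation fixes
    \<open>Z\<close>; the goals left to \<open>simp_all\<close> fix \<open>W\<close>.\<close>
  show "coproduct_bar m \<circ>\<^sub>C (W \<otimes>\<^sub>m clinmap_id) =
    ((transpose_map (Z \<otimes>\<^sub>m clinmap_id) + transpose_map (clinmap_id \<otimes>\<^sub>m Z)) \<otimes>\<^sub>m clinmap_id)
      \<circ>\<^sub>C coproduct_bar m"
    by (rule tensor_clinmap_eqI)
      (simp add: clinmap_compose.rep_eq coproduct_bar_def tensor_map_tmul clinmap_id.rep_eq
        coproduct_coLeibniz[OF assms])
qed (use assms(1) in simp_all)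

lemma coord_conv_fun:
  assumes "schwartz_fun f" "schwartz_fun g"
  shows "complex_of_real (x $ k) * conv_fun f g x =
    conv_fun (\<lambda>x. complex_of_real (x $ k) * f x) g x +
    conv_fun f (\<lambda>x. complex_of_real (x $ k) * g x) x"
proof -
  have "complex_of_real (x $ k) * conv_fun f g x =
      (\<integral>y. complex_of_real (y $ k) * f y * g (x - y) +
        f y * (complex_of_real ((x - y) $ k) * g (x - y)) \<partial>lborel)"
    unfolding conv_fun_def integral_mult_right_zero[symmetric]
    by (intro Bochner_Integration.integral_cong) (simp_all add: algebra_simps)
  \<comment> \<open>Splitting the integral needs both summands integrable; they are, since a
    coordinate times a Schwartz function is again Schwartz.\<close>
  also have "\<dots> = conv_fun (\<lambda>x. complex_of_real (x $ k) * f x) g x +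
      conv_fun f (\<lambda>x. complex_of_real (x $ k) * g x) x"
    unfolding conv_fun_def
    by (intro Bochner_Integration.integral_add convolution_integrable[of "\<lambda>y. complex_of_real (y $ k) * f y" g]
        convolution_integrable[of f "\<lambda>y. complex_of_real (y $ k) * g y"] schwartz_fun_coord assms)
  finally show ?thesis .
qed

lemma schwartz_coord_conv:
  "schwartz_coord k \<cdot> schwartz_conv f g =
    schwartz_conv (schwartz_coord k \<cdot> f) g + schwartz_conv f (schwartz_coord k \<cdot> g)"
  unfolding schwartz_coord.rep_eq by transfer (simp add: fun_eq_iff coord_conv_fun)

lemma schwartz_D_mult:
  "schwartz_D k \<cdot> schwartz_mult f g =
    schwartz_mult (schwartz_D k \<cdot> f) g + schwartz_mult f (schwartz_D k \<cdot> g)"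
  unfolding schwartz_D.rep_eq
  by transfer (simp add: fun_eq_iff partial_deriv_mult schwartz_fun_differentiable algebra_simps)

lemma is_adjoint_coord: "is_adjoint (tempered_coord k) (schwartz_coord k)"
  by (simp add: is_adjoint_def tempered_coord_apply)

text \<open>The sign in \<open>tempered_D\<close>, as in integration by parts, cancels against the
  one here.\<close>

lemma is_adjoint_D: "is_adjoint (- tempered_D k) (schwartz_D k)"
  by (simp add: is_adjoint_def tempered_D_apply uminus_clinmap.rep_eq uminus_tempered.rep_eq)

theorem corollary6p1:
  fixes k :: "'n::finite"
  shows "is_coderivation m_convolution (tempered_coord k \<otimes>\<^sub>m clinmap_id)
    \<and> is_coderivation m_pointwise ((- tempered_D k) \<otimes>\<^sub>m clinmap_id)"
  \<comment> \<open>The coderivation goals do not mention \<open>Z\<close>; each adjointness fact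
    supplies it.\<close>
  by (intro conjI coderivation_if_derivation[OF is_adjoint_coord]
      coderivation_if_derivation[OF is_adjoint_D])
    (simp_all add: m_convolution_tmul m_pointwise_tmul schwartz_coord_conv schwartz_D_mult)

end
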